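(* Let $D_0>0$ and $R>e$, and let $\mathbf g:\mathbb R\times\mathbb C^d\to\mathbb C^d$ be a periodic vector field with Fourier coefficients $\mathbf g_{\boldsymbol\alpha}(t)=[g_{1,\boldsymbol\alpha}(t),\ldots,g_{d,\boldsymbol\alpha}(t)]^T$, $\boldsymbol\alpha\in\mathbb Z^d$, satisfying $$\sup_{t\ge 0}\sum_{|\boldsymbol\alpha|=k}\sum_{j=1}^d |g_{j,\boldsymbol\alpha}(t)|\le D_0R^{-k},\qquad k\ge0 .$$ Let $\mathbf x(t)=[x_1(t),\ldots,x_d(t)]^T$ be the solution of $\dot{\mathbf x}=\mathbf g(t,\mathbf x)$, $t\ge0$, with initial state $\mathbf x(0)=\mathbf x_0$, and for $N\ge1$ let $\tilde{\mathbf v}_{1,N}(t)=[\tilde v_{1,N}(t),\ldots,\tilde v_{2d,N}(t)]^T$ be the first block of the finite-section approximation of order $N$ of the Carleman-Fourier linearization of the extended system (defined in the context). (i) If $\mathbf x_0\in\mathbb C^d$ satisfies $\max\{\|\exp(i\mathbf x_0)\|_\infty,\|\exp(-i\mathbf x_0)\|_\infty\}<R/e$, then $$\max\Big(\big|\tilde v_{j',N}(t)e^{-ix_{j'}(t)}-1\big|,\ \big|\tilde v_{j'+d,N}(t)e^{ix_{j'}(t)}-1\big|\Big)\le\frac{R^2}{\sqrt{2\pi}\,e(e-1)}N^{-3/2}e^{2D_0(t-\tilde T_{CF}^* )N}$$ for all $1\le j'\le d$ and $0\le t\le\tilde T_{CF}^*$, where $$\tilde T_{CF}^*=\frac{e-1}{2D_0(2e-1)}\Big(\ln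 R-1-\ln\max\{\|\exp(i\mathbf x_0)\|_\infty,\|\exp(-i\mathbf x_0)\|_\infty\}\Big).$$ (ii) If $\mathbf x_0\in\mathbb R^d$, then $$\max\Big(\big|\tilde v_{j',N}(t)e^{-ix_{j'}(t)}-1\big|,\ \big|\tilde v_{j'+d,N}(t)e^{ix_{j'}(t)}-1\big|\Big)\le\frac{R^2}{\sqrt{2\pi}\,e(e-1)N^{3/2}}\exp\Big(2D_0Nt-\frac{(e-1)(\ln R-1)}{2e-1}N\Big)$$ for all $1\le j'\le d$ and $0\le t\le\frac{(e-1)(\ln R-1)}{2D_0(2e-1)}$.
   Context: Notation: for $n\ge1$, $\mathbb Z_+^n$ is the set of $n$-tuples of nonnegative integers and $\mathbb Z_{+,k}^n=\{\boldsymbol\gamma\in\mathbb Z_+^n:|\boldsymbol\gamma|=k\}$, where $|\boldsymbol\gamma|=\sum_j|\gamma_j|$; $\boldsymbol\gamma\mathbf y=\sum_j\gamma_jy_j$. For $\boldsymbol\alpha\in\mathbb Z^d$, $\boldsymbol\alpha_+=[\max(\alpha_1,0),\ldots,\max(\alpha_d,0)]^T$ and $\boldsymbol\alpha_-=\boldsymbol\alpha_+-\boldsymbol\alpha$. $\exp(\pm i\mathbf x)$ is taken componentwise and $\|\cdot\|_\infty$ is the max norm on $\mathbb C^d$. The periodic vector field $\mathbf g$ is given by its Fourier expansion $\mathbf g(t,\mathbf x)=\sum_{\boldsymbol\alpha\in\mathbb Z^d}\mathbf g_{\boldsymbol\alpha}(t)e^{i\boldsymbol\alpha\mathbf x}$,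 which converges when $\max\{\|\exp(i\mathbf x)\|_\infty,\|\exp(-i\mathbf x)\|_\infty\}<R$. Extended system: let $\tilde{\mathbf x}=[\mathbf x^T,-\mathbf x^T]^T\in\mathbb C^{2d}$ and $\tilde{\mathbf x}_0=[\mathbf x_0^T,-\mathbf x_0^T]^T$. For $\boldsymbol\gamma\in\mathbb Z^{2d}$ define $\tilde{\mathbf g}_{\boldsymbol\gamma}(t)=[\tilde g_{1,\boldsymbol\gamma}(t),\ldots,\tilde g_{2d,\boldsymbol\gamma}(t)]^T$ by $\tilde g_{md+j',\boldsymbol\gamma}(t)=(-1)^mg_{j',\boldsymbol\alpha}(t)$ ($m\in\{0,1\}$, $1\le j'\le d$) if $\boldsymbol\gamma=[\boldsymbol\alpha_+^T,\boldsymbol\alpha_-^T]^T$ for some $\boldsymbol\alpha\in\mathbb Z^d$, and $\tilde{\mathbf g}_{\boldsymbol\gamma}(t)=\mathbf 0$ for all other $\boldsymbol\gamma$. Then $\dot{\tilde{\mathbf x}}=\sum_{\boldsymbol\gamma\in\mathbb Z_+^{2d}}\tilde{\mathbf g}_{\boldsymbol\gamma}(t)e^{i\boldsymbol\gamma\tilde{\mathbf x}}$. Finite sections: for $1\le k\le l$ put $$\tilde{\mathbf B}_{k,l}(t)=\Big[\,i\sum_{j=1}^{2d}\gamma_j\,\tilde g_{j,\boldsymbol\delta-\boldsymbol\gamma}(t)\Big]_{\boldsymbol\gamma\in\mathbb Z_{+,k}^{2d},\ \boldsymbol\delta\in\mathbb Z_{+,l}^{2d}} .$$ The finite-section approximation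 of order $N$ is the linear ODE system $$\dot{\tilde{\mathbf v}}_{k,N}(t)=\sum_{l=k}^N\tilde{\mathbf B}_{k,l}(t)\tilde{\mathbf v}_{l,N}(t),\qquad\tilde{\mathbf v}_{k,N}(0)=[e^{i\boldsymbol\gamma\tilde{\mathbf x}_0}]_{\boldsymbol\gamma\in\mathbb Z_{+,k}^{2d}},\qquad1\le k\le N .$$ The first block $\tilde{\mathbf v}_{1,N}$ is indexed by the unit vectors $\mathbf e_1,\ldots,\mathbf e_{2d}$; its entry with index $\mathbf e_j$ is the scalar denoted $\tilde v_{j,N}(t)$. *)

theory Defs
  imports "HOL-Analysis.Analysis"
begin

text \<open>
  Coordinates of vectors in dimension \<open>d\<close> are indexed by a finite type \<open>'d\<close> with \<open>d\<close> elements,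
  those of the extended system by \<open>'d + 'd\<close>: position \<open>m d + j\<close> is \<open>Inl j\<close> for \<open>m = 0\<close> and
  \<open>Inr j\<close> for \<open>m = 1\<close>.
\<close>

definition mi_abs :: "int ^ 'n::finite \<Rightarrow> int" where
  "mi_abs \<gamma> = (\<Sum>j\<in>UNIV. \<bar>\<gamma> $ j\<bar>)"

definition mi_dot :: "int ^ 'n::finite \<Rightarrow> complex ^ 'n \<Rightarrow> complex" where
  "mi_dot \<gamma> y = (\<Sum>j\<in>UNIV. of_int (\<gamma> $ j) * y $ j)"

definition nonneg_mi :: "nat \<Rightarrow> (int ^ 'n::finite) set" where
  "nonneg_mi k = {\<gamma>. (\<forall>j. 0 \<le> \<gamma> $ j) \<and> mi_abs \<gamma> = int k}"

lemma finite_mi_abs_eq: "finite {\<alpha> :: int ^ 'n::finite. mi_abs \<alpha> = int k}"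
proof -
  have "{\<alpha> :: int ^ 'n. mi_abs \<alpha> = int k} \<subseteq> vec_lambda ` (Pi\<^sub>E UNIV (\<lambda>_. {- int k..int k}))"
  proof
    fix \<alpha> :: "int ^ 'n"
    assume a: "\<alpha> \<in> {\<alpha>. mi_abs \<alpha> = int k}"
    have "\<bar>\<alpha> $ j\<bar> \<le> int k" for j
      using a member_le_sum[of j UNIV "\<lambda>j. \<bar>\<alpha> $ j\<bar>"] by (simp add: mi_abs_def)
    then have "vec_nth \<alpha> \<in> Pi\<^sub>E UNIV (\<lambda>_. {- int k..int k})"
      by (auto simp: abs_le_iff minus_le_iff)
    then show "\<alpha> \<in> vec_lambda ` (Pi\<^sub>E UNIV (\<lambda>_. {- int k..int k}))"
      by (metis image_eqI vec_nth_inverse)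
  qed
  then show ?thesis
    by (rule finite_subset) (intro finite_imageI finite_PiE; simp)
qed

lemma finite_nonneg_mi: "finite (nonneg_mi k)"
  by (rule finite_subset[OF _ finite_mi_abs_eq[of k]]) (auto simp: nonneg_mi_def)

text \<open>
  The max norm of a complex vector is the largest modulus of its entries. The library's
  \<^const>\<open>infnorm\<close> is different on \<open>complex ^ 'n\<close>: it takes real and imaginary parts separately.
\<close>

definition max_norm :: "complex ^ 'n::finite \<Rightarrow> real" where
  "max_norm z = Max (range (\<lambda>j. cmod (z $ j)))"

definition exp_size :: "complex ^ 'n::finite \<Rightarrow> real" where
  "exp_size x = max (max_norm (\<chi> j. exp (\<i> * x $ j))) (max_norm (\<chi> j. exp (- \<i> * x $ j)))"

definition periodic_field :: "(real \<Rightarrow> complex ^ 'd \<Rightarrow> complex ^ 'd::finite) \<Rightarrow> bool" where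
  "periodic_field g \<longleftrightarrow>
     (\<forall>t x (m :: int ^ 'd). g t (\<chi> j. x $ j + 2 * of_real pi * of_int (m $ j)) = g t x)"

text \<open>
  Nothing is required of \<open>g t x\<close> when \<open>exp_size x \<ge> R\<close>, where the Fourier series need not converge.
\<close>

definition has_fourier_expansion ::
  "real \<Rightarrow> (real \<Rightarrow> complex ^ 'd \<Rightarrow> complex ^ 'd::finite) \<Rightarrow> (int ^ 'd \<Rightarrow> real \<Rightarrow> complex ^ 'd) \<Rightarrow> bool"
where
  "has_fourier_expansion R g G \<longleftrightarrow>
     (\<forall>t x. 0 \<le> t \<longrightarrow> exp_size x < R \<longrightarrow>
        ((\<lambda>\<alpha>. exp (\<i> * mi_dot \<alpha> x) *s G \<alpha> t) has_sum g t x) UNIV)"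

definition is_solution ::
  "(real \<Rightarrow> complex ^ 'd \<Rightarrow> complex ^ 'd::finite) \<Rightarrow> complex ^ 'd \<Rightarrow> real \<Rightarrow> (real \<Rightarrow> complex ^ 'd) \<Rightarrow> bool"
where
  "is_solution g x0 T x \<longleftrightarrow>
     x 0 = x0 \<and> (\<forall>t\<in>{0..T}. (x has_vector_derivative g t (x t)) (at t within {0..T}))"

definition ext_state :: "complex ^ 'd::finite \<Rightarrow> complex ^ ('d + 'd)" where
  "ext_state x = (\<chi> s. case s of Inl j \<Rightarrow> x $ j | Inr j \<Rightarrow> - x $ j)"

definition mi_pos :: "int ^ 'd::finite \<Rightarrow> int ^ 'd" where
  "mi_pos \<alpha> = (\<chi> j. max (\<alpha> $ j) 0)"

definition mi_neg :: "int ^ 'd::finite \<Rightarrow> int ^ 'd" where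
  "mi_neg \<alpha> = mi_pos \<alpha> - \<alpha>"

definition ext_index :: "int ^ 'd::finite \<Rightarrow> int ^ ('d + 'd)" where
  "ext_index \<alpha> = (\<chi> s. case s of Inl j \<Rightarrow> mi_pos \<alpha> $ j | Inr j \<Rightarrow> mi_neg \<alpha> $ j)"

lemma inj_ext_index: "inj ext_index"
proof (rule injI)
  fix \<alpha> \<beta> :: "int ^ 'd"
  assume eq: "ext_index \<alpha> = ext_index \<beta>"
  have "ext_index \<alpha> $ s = ext_index \<beta> $ s" for s
    by (simp add: eq)
  from this[of "Inl _"] this[of "Inr _"]
  have "mi_pos \<alpha> $ j = mi_pos \<beta> $ j" "mi_neg \<alpha> $ j = mi_neg \<beta> $ j" for j
    by (simp_all add: ext_index_def)
  then show "\<alpha> = \<beta>"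
    by (simp add: vec_eq_iff mi_neg_def)
qed

definition ext_coeff ::
  "(int ^ 'd \<Rightarrow> real \<Rightarrow> complex ^ 'd::finite) \<Rightarrow> int ^ ('d + 'd) \<Rightarrow> real \<Rightarrow> complex ^ ('d + 'd)"
where
  "ext_coeff G \<gamma> t =
     (if \<gamma> \<in> range ext_index
      then (\<chi> s. case s of Inl j \<Rightarrow> G (inv ext_index \<gamma>) t $ j
                        | Inr j \<Rightarrow> - G (inv ext_index \<gamma>) t $ j)
      else 0)"

lemma ext_coeff_ext_index:
  "ext_coeff G (ext_index \<alpha>) t = (\<chi> s. case s of Inl j \<Rightarrow> G \<alpha> t $ j | Inr j \<Rightarrow> - G \<alpha> t $ j)"
  by (simp add: ext_coeff_def inv_f_f[OF inj_ext_index])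

definition block_entry ::
  "(int ^ 'd \<Rightarrow> real \<Rightarrow> complex ^ 'd::finite) \<Rightarrow> real \<Rightarrow> int ^ ('d + 'd) \<Rightarrow> int ^ ('d + 'd) \<Rightarrow> complex"
where
  "block_entry G t \<gamma> \<delta> = \<i> * (\<Sum>j\<in>UNIV. of_int (\<gamma> $ j) * ext_coeff G (\<delta> - \<gamma>) t $ j)"

text \<open>
  Here \<open>v k \<gamma> t\<close>, for \<open>\<gamma> \<in> nonneg_mi k\<close>, is the entry with index \<open>\<gamma>\<close> of the \<open>k\<close>-th block at
  time \<open>t\<close>; the values of \<open>v\<close> at other arguments play no role.
\<close>

definition is_finite_section ::
  "(int ^ 'd \<Rightarrow> real \<Rightarrow> complex ^ 'd::finite) \<Rightarrow> complex ^ 'd \<Rightarrow> nat \<Rightarrow> real \<Rightarrow>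
   (nat \<Rightarrow> int ^ ('d + 'd) \<Rightarrow> real \<Rightarrow> complex) \<Rightarrow> bool"
where
  "is_finite_section G x0 N T v \<longleftrightarrow>
     (\<forall>k\<in>{1..N}. \<forall>\<gamma>\<in>nonneg_mi k.
        v k \<gamma> 0 = exp (\<i> * mi_dot \<gamma> (ext_state x0)) \<and>
        (\<forall>t\<in>{0..T}.
           (v k \<gamma> has_vector_derivative
              (\<Sum>l=k..N. \<Sum>\<delta>\<in>nonneg_mi l. block_entry G t \<gamma> \<delta> * v l \<delta> t))
           (at t within {0..T})))"

definition T_CF :: "real \<Rightarrow> real \<Rightarrow> complex ^ 'd::finite \<Rightarrow> real" where
  "T_CF D0 R x0 =
     (exp 1 - 1) / (2 * D0 * (2 * exp 1 - 1)) * (ln R - 1 - ln (exp_size x0))"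

end

theory Submission
  imports Defs
begin

text \<open>
  The exponentials \<open>w\<^bsub>\<gamma>\<^esub>(t) = exp (\<i> \<gamma> \<cdot> (x, - x))\<close> of the exact solution satisfy the infinite
  Carleman-Fourier system, of which the finite section keeps the indices of degree at most
  \<open>N\<close>. Dividing the finite section by them, and writing \<open>u\<^bsub>\<gamma>\<^esub> = v\<^bsub>\<gamma>\<^esub> / w\<^bsub>\<gamma>\<^esub>\<close> for
  \<open>\<bar>\<gamma>\<bar> \<le> N\<close> and \<open>u\<^bsub>\<gamma>\<^esub> = 0\<close> for \<open>\<bar>\<gamma>\<bar> > N\<close>, gives the single formula
  \<open>u\<^bsub>\<gamma>\<^esub>' = (\<Sum>\<alpha>. b\<^bsub>\<gamma>,\<alpha>\<^esub>(t) exp (\<i> \<alpha> x(t)) (u\<^bsub>\<gamma>+\<alpha>\<^esub> - u\<^bsub>\<gamma>\<^esub>))\<close>, where \<open>\<gamma>+\<alpha>\<close> stands for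
  \<open>\<gamma> + ext_index \<alpha>\<close> and \<open>b\<close> for the block entries (\<open>normalized_derivative\<close>). It has the shape of
  the backward equation of a pure birth process: it raises the degree, its terms with
  \<open>\<alpha> = 0\<close> vanish, and \<open>u\<close> starts at 1, so \<open>u\<^bsub>\<gamma>\<^esub> - 1\<close> is fed only by the degrees above \<open>N\<close>, where
  it is \<open>-1\<close>. The quantities to be estimated are \<open>\<bar>u\<^bsub>\<gamma>\<^esub> - 1\<bar>\<close> for unit vectors \<open>\<gamma>\<close>.

  The coefficients are controlled by the moduli of \<open>exp (\<plusminus> \<i> x\<^sub>j)\<close>. As long as these are at most
  \<open>R / e\<close>, the components of the field are at most \<open>c = D0 * e / (e - 1)\<close>, so that \<open>\<bar>Im x\<^sub>j\<bar>\<close> grows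
  at most linearly with slope \<open>c\<close> (\<open>solution_Im_bound\<close>); the time horizon of the theorem is too
  short for leaving this region. The products of \<open>b\<^bsub>\<gamma>,\<alpha>\<^esub>\<close> and \<open>exp (\<i> \<alpha> x)\<close> over \<open>\<bar>\<alpha>\<bar> = m\<close> then sum to
  at most \<open>\<bar>\<gamma>\<bar> D0 \<rho>^m\<close>, where \<open>\<rho> \<le> 1/e\<close> is the bound on the moduli divided by \<open>R\<close>, a multiple of
  \<open>exp (c s)\<close> at time \<open>s\<close>.

  The functions \<open>\<phi>\<^bsub>\<gamma>\<^esub>(s) = lam^(N+1) * (exp (c s) / lam)^\<bar>\<gamma>\<bar>\<close> are barriers for \<open>\<bar>u\<^bsub>\<gamma>\<^esub> - 1\<bar>\<close>:
  they are geometric in the degree, so that the infinite sum over \<open>\<alpha>\<close> can be carried out; they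
  are at least 1 for \<open>\<bar>\<gamma>\<bar> > N\<close> if \<open>lam \<le> 1\<close>; and with \<open>lam = 2 \<rho> exp (c t)\<close>, where \<open>\<rho>\<close> is taken
  at time \<open>t\<close>, the sum is up to time \<open>t\<close> at most \<open>1 + 1/(e - 1) = e/(e - 1)\<close> in units of
  \<open>\<bar>\<gamma>\<bar> D0 \<phi>\<^bsub>\<gamma>\<^esub>\<close>, hence at most \<open>\<phi>\<^bsub>\<gamma>\<^esub>'\<close>. For unit vectors the outcome is
  \<open>\<bar>u\<^bsub>\<gamma>\<^esub> - 1\<bar> \<le> lam^N (exp (c t) - 1)\<close> at time \<open>t\<close> (\<open>normalized_minus_1_bound\<close>). At times up to the
  horizon this is at most the closed form that is claimed, because \<open>lam\<close> contains the factor
  \<open>2/e\<close>, whose powers decay faster than \<open>N powr (-3/2)\<close>, and \<open>R\<^sup>2\<close> absorbs \<open>exp (c t)\<close>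
  (\<open>closed_form_bound\<close>).
\<close>

section \<open>Differential inequalities and sums over shells\<close>

text \<open>
  A comparison principle for finitely many functions at once. The slopes need to be dominated
  only at times at which all functions are below their barriers, which suffices because the
  barriers cannot be reached for a first time: until then domination of the slopes has preserved
  the initial gap. The conclusion subtracts \<open>\<phi> i 0\<close>, so that the bound is sharp at time 0 although
  the barriers start strictly above.
\<close>

lemma barrier_comparison:
  fixes f f' :: "'i \<Rightarrow> real \<Rightarrow> 'a::real_normed_vector" and \<phi> \<phi>' :: "'i \<Rightarrow> real \<Rightarrow> real"
  assumes fin: "finite I"
    and df: "\<And>i s. i \<in> I \<Longrightarrow> s \<in> {0..t} \<Longrightarrow>
               (f i has_vector_derivative f' i s) (at s within {0..t})"
    and d\<phi>: "\<And>i s. i \<in> I \<Longrightarrow> s \<in> {0..t} \<Longrightarrow>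
               (\<phi> i has_vector_derivative \<phi>' i s) (at s within {0..t})"
    and start: "\<And>i. i \<in> I \<Longrightarrow> norm (f i 0) < \<phi> i 0"
    and slope: "\<And>s i. s \<in> {0..t} \<Longrightarrow> (\<And>j. j \<in> I \<Longrightarrow> norm (f j s) \<le> \<phi> j s) \<Longrightarrow> i \<in> I \<Longrightarrow>
               norm (f' i s) \<le> \<phi>' i s"
    and "i \<in> I" and "s \<in> {0..t}"
  shows "norm (f i s) \<le> norm (f i 0) + \<phi> i s - \<phi> i 0"
proof -
  have cf: "continuous_on {0..t} (f i)" and c\<phi>: "continuous_on {0..t} (\<phi> i)" if "i \<in> I" for i
    using df[OF that] d\<phi>[OF that] by (blast intro: continuous_on_vector_derivative)+
  have growth: "norm (f i s) \<le> norm (f i 0) + \<phi> i s - \<phi> i 0"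
    if i: "i \<in> I" and s: "s \<in> {0..t}"
      and below: "\<And>r j. 0 \<le> r \<Longrightarrow> r < s \<Longrightarrow> j \<in> I \<Longrightarrow> norm (f j r) < \<phi> j r" for i s
  proof (cases "s = 0")
    case False
    then have "0 < s" using s by simp
    have sub: "{0..s} \<subseteq> {0..t}" using s by auto
    have at: "at r within {0..t} = at r" if "0 < r" "r < s" for r
      using that s by (intro at_within_interior) (auto simp: interior_atLeastAtMost_real)
    have "norm (f i s - f i 0) \<le> \<phi> i s - \<phi> i 0"
    proof (rule differentiable_bound_general[OF \<open>0 < s\<close>, where f' = "f' i" and \<phi>' = "\<phi>' i"])
      show "continuous_on {0..s} (f i)" "continuous_on {0..s} (\<phi> i)"
        using cf[OF i] c\<phi>[OF i] sub continuous_on_subset by blast+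
      fix r assume r: "0 < r" "r < s"
      then have rt: "r \<in> {0..t}" using s by auto
      show "(f i has_vector_derivative f' i r) (at r)"
        "(\<phi> i has_vector_derivative \<phi>' i r) (at r)"
        using df[OF i rt] d\<phi>[OF i rt] by (simp_all add: at[OF r])
      show "norm (f' i r) \<le> \<phi>' i r"
        using r by (intro slope[OF rt _ i] less_imp_le[OF below]) auto
    qed
    then show ?thesis
      using norm_triangle_ineq2[of "f i s" "f i 0"] by simp
  qed simp
  define S where "S = (\<Union>i\<in>I. {s \<in> {0..t}. \<phi> i s \<le> norm (f i s)})"
  have "compact S"
    unfolding S_def compact_eq_bounded_closed
  proof
    show "bounded (\<Union>i\<in>I. {s \<in> {0..t}. \<phi> i s \<le> norm (f i s)})"
      by (rule bounded_subset[of "{0..t}"]) auto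
    show "closed (\<Union>i\<in>I. {s \<in> {0..t}. \<phi> i s \<le> norm (f i s)})"
      using fin cf c\<phi> by (intro closed_UN ballI continuous_on_closed_Collect_le continuous_on_norm) auto
  qed
  have "S = {}"
  proof (rule ccontr)
    \<comment> \<open>At the first time where a barrier is reached, all derivatives have been dominated so far.\<close>
    assume "S \<noteq> {}"
    then obtain m where m: "m \<in> S" "\<And>r. r \<in> S \<Longrightarrow> m \<le> r"
      using compact_attains_inf[OF \<open>compact S\<close>] by blast
    then obtain i where i: "i \<in> I" "m \<in> {0..t}" "\<phi> i m \<le> norm (f i m)"
      by (auto simp: S_def)
    have "norm (f j r) < \<phi> j r" if "0 \<le> r" "r < m" "j \<in> I" for r j
      using m(2)[of r] that i(2) by (force simp: S_def)
    then have "norm (f i m) \<le> norm (f i 0) + \<phi> i m - \<phi> i 0"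
      by (rule growth[OF i(1,2)])
    then show False using start[OF i(1)] i(3) by simp
  qed
  have "norm (f j r) < \<phi> j r" if "0 \<le> r" "r < s" "j \<in> I" for r j
  proof -
    have "r \<in> {0..t}" "r \<notin> S" using that \<open>s \<in> {0..t}\<close> \<open>S = {}\<close> by auto
    then show ?thesis using that by (auto simp: S_def not_le)
  qed
  then show ?thesis
    by (rule growth[OF assms(6,7)])
qed

text \<open>
  Any finite set of multi-indices lies in finitely many shells \<open>mi_abs \<alpha> = m\<close>, so bounds on the
  shells control all partial sums.
\<close>

lemma norm_has_sum_le_shells:
  fixes h :: "int ^ 'n::finite \<Rightarrow> 'a::real_normed_vector"
  assumes h: "(h has_sum S) UNIV"
    and shell: "\<And>m. (\<Sum>\<alpha> | mi_abs \<alpha> = int m. norm (h \<alpha>)) \<le> c m"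
    and c: "c sums C"
  shows "norm S \<le> C"
proof (rule Lim_norm_ubound)
  show "(sum h \<longlongrightarrow> S) (finite_subsets_at_top UNIV)"
    using h by (simp add: has_sum_def)
  have cn: "0 \<le> c m" for m
    using shell[of m] sum_nonneg[of _ "\<lambda>\<alpha>. norm (h \<alpha>)"] by (meson norm_ge_zero order_trans)
  have "norm (sum h F) \<le> C" if F: "finite F" for F
  proof -
    obtain K where K: "\<And>\<alpha>. \<alpha> \<in> F \<Longrightarrow> nat (mi_abs \<alpha>) \<le> K"
      using F finite_nat_set_iff_bounded_le[of "(\<lambda>\<alpha>. nat (mi_abs \<alpha>)) ` F"] by auto
    have pos: "0 \<le> mi_abs \<alpha>" for \<alpha> :: "int ^ 'n"
      by (simp add: mi_abs_def sum_nonneg)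
    have sub: "F \<subseteq> (\<Union>m\<le>K. {\<alpha>. mi_abs \<alpha> = int m})"
    proof
      fix \<alpha> assume "\<alpha> \<in> F"
      then show "\<alpha> \<in> (\<Union>m\<le>K. {\<alpha>. mi_abs \<alpha> = int m})"
        using K[of \<alpha>] pos[of \<alpha>] by (auto intro!: bexI[of _ "nat (mi_abs \<alpha>)"])
    qed
    have "norm (sum h F) \<le> (\<Sum>\<alpha>\<in>F. norm (h \<alpha>))" by (rule norm_sum)
    also have "\<dots> \<le> (\<Sum>\<alpha>\<in>(\<Union>m\<le>K. {\<alpha>. mi_abs \<alpha> = int m}). norm (h \<alpha>))"
      by (intro sum_mono2 sub) (auto simp: finite_mi_abs_eq)
    also have "\<dots> = (\<Sum>m\<le>K. \<Sum>\<alpha> | mi_abs \<alpha> = int m. norm (h \<alpha>))"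
      by (intro sum.UNION_disjoint) (auto simp: finite_mi_abs_eq)
    also have "\<dots> \<le> (\<Sum>m\<le>K. c m)" by (intro sum_mono shell)
    also have "\<dots> \<le> suminf c"
      using c cn by (intro sum_le_suminf) (auto simp: sums_iff)
    finally show ?thesis using c by (simp add: sums_iff)
  qed
  then show "\<forall>\<^sub>F F in finite_subsets_at_top UNIV. norm (sum h F) \<le> C"
    by (intro eventually_finite_subsets_at_top_weakI) auto
qed auto

section \<open>Multi-indices and the extended system\<close>

lemma mi_abs_nonneg: "0 \<le> mi_abs \<alpha>"
  by (simp add: mi_abs_def sum_nonneg)

lemma mi_abs_eq_0_iff: "mi_abs \<alpha> = 0 \<longleftrightarrow> \<alpha> = 0"
  by (simp add: mi_abs_def sum_nonneg_eq_0_iff vec_eq_iff)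

lemma sum_UNIV_Plus:
  fixes f :: "'a::finite + 'b::finite \<Rightarrow> 'c::comm_monoid_add"
  shows "(\<Sum>s\<in>UNIV. f s) = (\<Sum>j\<in>UNIV. f (Inl j)) + (\<Sum>j\<in>UNIV. f (Inr j))"
  by (simp flip: UNIV_Plus_UNIV add: sum.Plus)

lemma mi_dot_add: "mi_dot (\<alpha> + \<beta>) y = mi_dot \<alpha> y + mi_dot \<beta> y"
  by (simp add: mi_dot_def algebra_simps sum.distrib)

lemma bounded_linear_mi_dot: "bounded_linear (mi_dot \<alpha>)"
  unfolding mi_dot_def
  by (intro bounded_linear_sum bounded_linear_const_mult bounded_linear_vec_nth)

lemma mi_dot_scale: "mi_dot \<alpha> (c *s y) = c * mi_dot \<alpha> y"
  by (simp add: mi_dot_def sum_distrib_left algebra_simps)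

lemma axis_in_nonneg_mi: "axis s 1 \<in> nonneg_mi 1"
proof -
  have "mi_abs (axis s (1::int)) = 1"
    by (simp add: mi_abs_def axis_def if_distrib[of abs] cong: if_cong)
  then show ?thesis by (simp add: nonneg_mi_def axis_def)
qed

lemma mi_dot_axis: "mi_dot (axis s 1) y = y $ s"
  by (simp add: mi_dot_def axis_def if_distrib[of of_int] if_distrib[of "\<lambda>c. c * _"] cong: if_cong)

text \<open>
  Since the extended state is \<open>(x, - x)\<close>, an index \<open>\<gamma>\<close> of the extended system acts on it like the
  integer index \<open>ext_fold \<gamma>\<close> acts on \<open>x\<close>. It is a left inverse of \<open>ext_index\<close>.
\<close>

definition ext_fold :: "int ^ ('d + 'd) \<Rightarrow> int ^ 'd::finite" where
  "ext_fold \<gamma> = (\<chi> j. \<gamma> $ Inl j - \<gamma> $ Inr j)"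

lemma mi_dot_ext_state: "mi_dot \<gamma> (ext_state x) = mi_dot (ext_fold \<gamma>) x"
  by (simp add: mi_dot_def ext_state_def ext_fold_def sum_UNIV_Plus algebra_simps
      sum_subtractf sum_negf)

lemma ext_fold_add_ext_index: "ext_fold (\<gamma> + ext_index \<alpha>) = ext_fold \<gamma> + \<alpha>"
  by (simp add: ext_fold_def ext_index_def mi_neg_def vec_eq_iff)

lemma mi_abs_ext_index: "mi_abs (ext_index \<alpha>) = mi_abs \<alpha>"
  by (simp add: mi_abs_def ext_index_def mi_neg_def mi_pos_def sum_UNIV_Plus flip: sum.distrib)
     (auto intro!: sum.cong)

lemma nonneg_add_ext_index:
  assumes "\<gamma> \<in> nonneg_mi k"
  shows "\<gamma> + ext_index \<alpha> \<in> nonneg_mi (k + nat (mi_abs \<alpha>))"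
proof -
  have p: "0 \<le> ext_index \<alpha> $ s" for s
    by (simp add: ext_index_def mi_pos_def mi_neg_def split: sum.split)
  have "mi_abs (\<gamma> + ext_index \<alpha>) = mi_abs \<gamma> + mi_abs (ext_index \<alpha>)"
    using assms p by (simp add: mi_abs_def nonneg_mi_def flip: sum.distrib)
  then show ?thesis
    using assms p mi_abs_nonneg[of \<alpha>] by (simp add: nonneg_mi_def mi_abs_ext_index)
qed

lemma abs_ext_fold_le:
  assumes "\<gamma> \<in> nonneg_mi k"
  shows "\<bar>ext_fold \<gamma> $ j\<bar> \<le> int k"
proof -
  have "\<bar>ext_fold \<gamma> $ j\<bar> \<le> \<bar>\<gamma> $ Inl j\<bar> + \<bar>\<gamma> $ Inr j\<bar>"
    by (simp add: ext_fold_def)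
  also have "\<dots> \<le> (\<Sum>j\<in>UNIV. \<bar>\<gamma> $ Inl j\<bar>) + (\<Sum>j\<in>UNIV. \<bar>\<gamma> $ Inr j\<bar>)"
    by (intro add_mono member_le_sum) auto
  also have "\<dots> = int k"
    using assms unfolding nonneg_mi_def mi_abs_def sum_UNIV_Plus by blast
  finally show ?thesis .
qed

section \<open>Entries of the finite section\<close>

lemma block_entry_add_ext_index:
  "block_entry G t \<gamma> (\<gamma> + ext_index \<alpha>) = \<i> * mi_dot (ext_fold \<gamma>) (G \<alpha> t)"
  by (simp add: block_entry_def mi_dot_def ext_coeff_ext_index sum_UNIV_Plus ext_fold_def algebra_simps
      sum_subtractf sum_negf)

lemma block_entry_eq_0: "\<delta> - \<gamma> \<notin> range ext_index \<Longrightarrow> block_entry G t \<gamma> \<delta> = 0"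
  by (simp add: block_entry_def ext_coeff_def)

lemma norm_block_entry_le:
  assumes "\<gamma> \<in> nonneg_mi k"
  shows "cmod (block_entry G t \<gamma> (\<gamma> + ext_index \<alpha>)) \<le> real k * (\<Sum>j\<in>UNIV. cmod (G \<alpha> t $ j))"
proof -
  have abs: "\<bar>real_of_int (ext_fold \<gamma> $ j)\<bar> \<le> real k" for j
    using abs_ext_fold_le[OF assms, of j] by linarith
  have "cmod (mi_dot (ext_fold \<gamma>) (G \<alpha> t)) \<le> (\<Sum>j\<in>UNIV. real k * cmod (G \<alpha> t $ j))"
    unfolding mi_dot_def
    by (intro order_trans[OF norm_sum] sum_mono) (simp add: norm_mult mult_right_mono abs)
  then show ?thesis
    unfolding block_entry_add_ext_index norm_mult sum_distrib_left[symmetric] by simp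
qed

text \<open>
  Only indices \<open>\<delta> = \<gamma> + ext_index \<alpha>\<close> contribute to a row, and the truncation to degree at most \<open>N\<close>
  may be expressed by setting the unknowns of higher degree to 0. In this form the row can be
  compared term by term with the Fourier series of the field.
\<close>

lemma section_row_has_sum:
  fixes G :: "int ^ 'd \<Rightarrow> real \<Rightarrow> complex ^ 'd::finite"
  assumes \<gamma>: "\<gamma> \<in> nonneg_mi k"
  shows "((\<lambda>\<alpha>. block_entry G t \<gamma> (\<gamma> + ext_index \<alpha>) *
            (if mi_abs (\<gamma> + ext_index \<alpha>) \<le> int N
             then v (nat (mi_abs (\<gamma> + ext_index \<alpha>))) (\<gamma> + ext_index \<alpha>) t else 0))
          has_sum (\<Sum>l=k..N. \<Sum>\<delta>\<in>nonneg_mi l. block_entry G t \<gamma> \<delta> * v l \<delta> t)) UNIV"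
proof -
  define D :: "(int ^ ('d + 'd)) set" where "D = (\<Union>l\<in>{k..N}. nonneg_mi l)"
  define V where "V \<delta> = v (nat (mi_abs \<delta>)) \<delta> t" for \<delta>
  define A where "A = {\<alpha> :: int ^ 'd. mi_abs (\<gamma> + ext_index \<alpha>) \<le> int N}"
  define sh where "sh \<alpha> = \<gamma> + ext_index \<alpha>" for \<alpha> :: "int ^ 'd"
  have abs: "mi_abs (\<gamma> + ext_index \<alpha>) = int k + mi_abs \<alpha>" for \<alpha>
    using nonneg_add_ext_index[OF \<gamma>, of \<alpha>] mi_abs_nonneg[of \<alpha>] by (simp add: nonneg_mi_def)
  have finD: "finite D" by (simp add: D_def finite_nonneg_mi)
  have inj: "inj_on sh A"
    by (rule inj_onI) (auto simp: sh_def dest: injD[OF inj_ext_index])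
  have sub: "sh ` A \<subseteq> D"
  proof
    fix \<delta> assume "\<delta> \<in> sh ` A"
    then obtain \<alpha> where a: "\<delta> = \<gamma> + ext_index \<alpha>" "int k + mi_abs \<alpha> \<le> int N"
      by (auto simp: A_def sh_def abs)
    then show "\<delta> \<in> D"
      using nonneg_add_ext_index[OF \<gamma>, of \<alpha>] mi_abs_nonneg[of \<alpha>]
      by (auto simp: D_def intro!: bexI[of _ "k + nat (mi_abs \<alpha>)"])
  qed
  have zero: "block_entry G t \<gamma> \<delta> * V \<delta> = 0" if "\<delta> \<in> D - sh ` A" for \<delta>
  proof -
    have "\<delta> - \<gamma> \<notin> range ext_index"
    proof
      assume "\<delta> - \<gamma> \<in> range ext_index"
      then obtain \<alpha> where "\<delta> - \<gamma> = ext_index \<alpha>" by blast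
      then have "\<delta> = sh \<alpha>" by (simp add: sh_def algebra_simps)
      moreover have "mi_abs \<delta> \<le> int N"
        using that by (auto simp: D_def nonneg_mi_def)
      ultimately show False using that by (auto simp: A_def sh_def)
    qed
    then show ?thesis by (simp add: block_entry_eq_0)
  qed
  have "(\<Sum>l=k..N. \<Sum>\<delta>\<in>nonneg_mi l. block_entry G t \<gamma> \<delta> * v l \<delta> t)
      = (\<Sum>l\<in>{k..N}. \<Sum>\<delta>\<in>nonneg_mi l. block_entry G t \<gamma> \<delta> * V \<delta>)"
    by (intro sum.cong refl) (auto simp: V_def nonneg_mi_def)
  also have "\<dots> = (\<Sum>\<delta>\<in>D. block_entry G t \<gamma> \<delta> * V \<delta>)"
    unfolding D_def
    by (rule sum.UNION_disjoint[symmetric]) (auto simp: finite_nonneg_mi, auto simp: nonneg_mi_def)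
  also have "\<dots> = (\<Sum>\<delta>\<in>sh ` A. block_entry G t \<gamma> \<delta> * V \<delta>)"
    using finD sub zero by (intro sum.mono_neutral_right) auto
  also have "\<dots> = (\<Sum>\<alpha>\<in>A. block_entry G t \<gamma> (sh \<alpha>) * V (sh \<alpha>))"
    using inj by (simp add: sum.reindex)
  finally have eq: "(\<Sum>l=k..N. \<Sum>\<delta>\<in>nonneg_mi l. block_entry G t \<gamma> \<delta> * v l \<delta> t)
      = (\<Sum>\<alpha>\<in>A. block_entry G t \<gamma> (sh \<alpha>) * V (sh \<alpha>))" .
  have "finite A"
    using inj finD sub finite_imageD finite_subset by blast
  then show ?thesis
    by (rule has_sum_finite_neutralI) (auto simp: eq A_def V_def sh_def)
qed

section \<open>Growth of the imaginary parts of the solution\<close>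

lemma max_norm_le_iff: "max_norm z \<le> r \<longleftrightarrow> (\<forall>j. cmod (z $ j) \<le> r)"
  by (simp add: max_norm_def)

lemma exp_size_le_exp_iff: "exp_size x \<le> exp b \<longleftrightarrow> (\<forall>j. \<bar>Im (x $ j)\<bar> \<le> b)"
  by (auto simp: exp_size_def max_norm_le_iff norm_exp_eq_Re abs_le_iff minus_le_iff)

lemma exp_size_ge_1: "1 \<le> exp_size x"
proof (rule ccontr)
  assume "\<not> 1 \<le> exp_size x"
  then obtain r where r: "exp_size x < r" "0 < r" "r < 1"
    by (metis dense max_less_iff_conj not_le zero_less_one)
  then have "exp_size x \<le> exp (ln r)" by simp
  then have "\<bar>Im (x $ j)\<bar> \<le> ln r" for j
    by (simp only: exp_size_le_exp_iff)
  moreover have "ln r < 0" using r by simp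
  ultimately show False
    by (metis abs_ge_zero not_le order_trans)
qed

lemma abs_Im_le_ln_exp_size: "\<bar>Im (x $ j)\<bar> \<le> ln (exp_size x)"
  using exp_size_le_exp_iff[of x "ln (exp_size x)"] exp_size_ge_1[of x] by simp

lemma norm_exp_mi_dot_le:
  assumes "\<And>j. \<bar>Im (x $ j)\<bar> \<le> b"
  shows "cmod (exp (\<i> * mi_dot \<alpha> x)) \<le> exp b ^ nat (mi_abs \<alpha>)"
proof -
  have "- Im (mi_dot \<alpha> x) = (\<Sum>j\<in>UNIV. - (real_of_int (\<alpha> $ j) * Im (x $ j)))"
    by (simp add: mi_dot_def sum_negf)
  also have "\<dots> \<le> (\<Sum>j\<in>UNIV. real_of_int \<bar>\<alpha> $ j\<bar> * b)"
  proof (rule sum_mono)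
    fix j
    have "- (real_of_int (\<alpha> $ j) * Im (x $ j)) \<le> \<bar>real_of_int (\<alpha> $ j) * Im (x $ j)\<bar>" by simp
    also have "\<dots> \<le> real_of_int \<bar>\<alpha> $ j\<bar> * b"
      using assms by (simp add: abs_mult mult_left_mono)
    finally show "- (real_of_int (\<alpha> $ j) * Im (x $ j)) \<le> real_of_int \<bar>\<alpha> $ j\<bar> * b" .
  qed
  also have "\<dots> = real (nat (mi_abs \<alpha>)) * b"
    using mi_abs_nonneg[of \<alpha>] by (simp add: mi_abs_def sum_distrib_right)
  finally show ?thesis
    by (simp add: norm_exp_eq_Re flip: exp_of_nat_mult)
qed

lemma fourier_shell_bound:
  fixes G :: "int ^ 'd \<Rightarrow> real \<Rightarrow> complex ^ 'd::finite"
  assumes R: "0 < R"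
    and G: "\<And>k. (\<Sum>\<alpha> | mi_abs \<alpha> = int k. \<Sum>j\<in>UNIV. cmod (G \<alpha> t $ j)) \<le> D0 * R powi (- int k)"
    and b: "\<And>j. \<bar>Im (x $ j)\<bar> \<le> b"
  shows "(\<Sum>\<alpha> | mi_abs \<alpha> = int m. cmod (exp (\<i> * mi_dot \<alpha> x)) * (\<Sum>j\<in>UNIV. cmod (G \<alpha> t $ j)))
           \<le> D0 * (exp b / R) ^ m"
proof -
  have "(\<Sum>\<alpha> | mi_abs \<alpha> = int m. cmod (exp (\<i> * mi_dot \<alpha> x)) * (\<Sum>j\<in>UNIV. cmod (G \<alpha> t $ j)))
      \<le> (\<Sum>\<alpha> | mi_abs \<alpha> = int m. exp b ^ m * (\<Sum>j\<in>UNIV. cmod (G \<alpha> t $ j)))"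
  proof (rule sum_mono, rule mult_right_mono)
    fix \<alpha> :: "int ^ 'd" assume "\<alpha> \<in> {\<alpha>. mi_abs \<alpha> = int m}"
    then show "cmod (exp (\<i> * mi_dot \<alpha> x)) \<le> exp b ^ m"
      using norm_exp_mi_dot_le[OF b, of \<alpha>] by simp
  qed (simp add: sum_nonneg)
  also have "\<dots> \<le> exp b ^ m * (D0 * R powi (- int m))"
    unfolding sum_distrib_left[symmetric] by (intro mult_left_mono G) simp
  also have "\<dots> = D0 * (exp b / R) ^ m"
    using R by (simp add: power_int_minus field_simps)
  finally show ?thesis .
qed

text \<open>
  The value of \<open>\<Sum>m. e^(-m)\<close>. It bounds the speed of the solution, in units of \<open>D0\<close>, as long as
  the moduli of \<open>exp (\<plusminus> \<i> x\<^sub>j)\<close> are at most \<open>R / e\<close>.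
\<close>

definition speed_const :: real where "speed_const = exp 1 / (exp 1 - 1)"

lemma speed_const_eq: "speed_const = 1 / (1 - 1 / exp 1)" "speed_const = 1 + 1 / (exp 1 - 1)"
  using exp_gt_one[of "1::real"] by (simp_all add: speed_const_def field_simps)

lemma speed_const_pos: "0 < speed_const"
  using exp_gt_one[of "1::real"] by (simp add: speed_const_def)

lemma geometric_sums_speed_const: "(\<lambda>m. (1 / exp 1) ^ m) sums speed_const"
  unfolding speed_const_eq(1) by (rule geometric_sums) simp

lemma norm_field_le:
  fixes G :: "int ^ 'd \<Rightarrow> real \<Rightarrow> complex ^ 'd::finite"
  assumes R: "0 < R" and D0: "0 \<le> D0" and t: "0 \<le> t"
    and four: "has_fourier_expansion R g G"
    and G: "\<And>k. (\<Sum>\<alpha> | mi_abs \<alpha> = int k. \<Sum>j\<in>UNIV. cmod (G \<alpha> t $ j)) \<le> D0 * R powi (- int k)"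
    and b: "\<And>j. \<bar>Im (x $ j)\<bar> \<le> ln R - 1"
  shows "cmod (g t x $ j) \<le> D0 * speed_const"
proof (rule norm_has_sum_le_shells)
  have "exp_size x \<le> exp (ln R - 1)" using b by (simp add: exp_size_le_exp_iff)
  also have "\<dots> < R" using R by (simp add: exp_diff divide_less_eq)
  finally have "((\<lambda>\<alpha>. exp (\<i> * mi_dot \<alpha> x) *s G \<alpha> t) has_sum g t x) UNIV"
    using four t by (simp add: has_fourier_expansion_def)
  from has_sum_bounded_linear[OF bounded_linear_vec_nth this, of j]
  show "((\<lambda>\<alpha>. exp (\<i> * mi_dot \<alpha> x) * G \<alpha> t $ j) has_sum g t x $ j) UNIV"
    by simp
  show "(\<lambda>m. D0 * (1 / exp 1) ^ m) sums (D0 * speed_const)"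
    by (intro sums_mult geometric_sums_speed_const)
  fix m
  have "(\<Sum>\<alpha> | mi_abs \<alpha> = int m. cmod (exp (\<i> * mi_dot \<alpha> x) * G \<alpha> t $ j))
     \<le> (\<Sum>\<alpha> | mi_abs \<alpha> = int m. cmod (exp (\<i> * mi_dot \<alpha> x)) * (\<Sum>j\<in>UNIV. cmod (G \<alpha> t $ j)))"
    unfolding norm_mult by (intro sum_mono mult_left_mono member_le_sum) auto
  also have "\<dots> \<le> D0 * (exp (ln R - 1) / R) ^ m"
    using R G b by (rule fourier_shell_bound)
  also have "exp (ln R - 1) / R = 1 / exp 1" using R by (simp add: exp_diff)
  finally show "(\<Sum>\<alpha> | mi_abs \<alpha> = int m. cmod (exp (\<i> * mi_dot \<alpha> x) * G \<alpha> t $ j))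
     \<le> D0 * (1 / exp 1) ^ m" .
qed

text \<open>
  The speed bound of \<open>norm_field_le\<close> is available only while the solution stays in the region
  \<open>\<bar>Im x\<^sub>j\<bar> \<le> ln R - 1\<close>, and staying there follows from the speed bound; the barrier argument
  resolves the circularity.
\<close>

lemma solution_Im_bound:
  fixes G :: "int ^ 'd \<Rightarrow> real \<Rightarrow> complex ^ 'd::finite"
  assumes R: "0 < R" and D0: "0 \<le> D0"
    and four: "has_fourier_expansion R g G"
    and G: "\<And>k t. 0 \<le> t \<Longrightarrow>
              (\<Sum>\<alpha> | mi_abs \<alpha> = int k. \<Sum>j\<in>UNIV. cmod (G \<alpha> t $ j)) \<le> D0 * R powi (- int k)"
    and sol: "is_solution g x0 T x" and "t \<le> T"
    and b0: "\<And>j. \<bar>Im (x0 $ j)\<bar> \<le> b"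
    and room: "b + speed_const * D0 * t < ln R - 1"
    and s: "s \<in> {0..t}"
  shows "\<bar>Im (x s $ j)\<bar> \<le> b + speed_const * D0 * s"
proof -
  \<comment> \<open>The barrier needs a strict inequality at time 0.\<close>
  define b' where "b' = ln R - 1 - speed_const * D0 * t"
  have b': "b < b'" using room by (simp add: b'_def)
  have Dx: "((\<lambda>s. Im (x s $ j)) has_vector_derivative Im (g s (x s) $ j)) (at s within {0..t})"
    if "s \<in> {0..t}" for s j
  proof -
    have "(x has_vector_derivative g s (x s)) (at s within {0..t})"
      using sol that \<open>t \<le> T\<close> unfolding is_solution_def
      by (fastforce intro: has_vector_derivative_within_subset[of x _ s "{0..T}" "{0..t}"])
    from bounded_linear.has_vector_derivative[OF bounded_linear_vec_nth this]
    have "((\<lambda>s. x s $ j) has_vector_derivative g s (x s) $ j) (at s within {0..t})" .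
    from bounded_linear.has_vector_derivative[OF bounded_linear_Im this] show ?thesis .
  qed
  have "norm (Im (x s $ j)) \<le> norm (Im (x 0 $ j)) + (b' + speed_const * D0 * s) - (b' + speed_const * D0 * 0)"
  proof (rule barrier_comparison[where I = UNIV and t = t and f = "\<lambda>j s. Im (x s $ j)"
        and f' = "\<lambda>j s. Im (g s (x s) $ j)" and \<phi> = "\<lambda>_ s. b' + speed_const * D0 * s"
        and \<phi>' = "\<lambda>_ _. speed_const * D0"])
    fix s i assume s: "s \<in> {0..t}" and below: "\<And>j. j \<in> UNIV \<Longrightarrow> norm (Im (x s $ j)) \<le> b' + speed_const * D0 * s"
    have "speed_const * D0 * s \<le> speed_const * D0 * t"
      using s D0 speed_const_pos by (intro mult_left_mono) auto
    then have "\<bar>Im (x s $ j)\<bar> \<le> ln R - 1" for j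
      using below[of j] by (simp add: b'_def)
    then have "cmod (g s (x s) $ i) \<le> D0 * speed_const"
      using s by (intro norm_field_le[OF R D0 _ four G]) auto
    then show "norm (Im (g s (x s) $ i)) \<le> speed_const * D0"
      using abs_Im_le_cmod[of "g s (x s) $ i"] by (simp add: mult.commute)
  next
    fix i show "norm (Im (x 0 $ i)) < b' + speed_const * D0 * 0"
      using sol b0[of i] b' by (simp add: is_solution_def)
  qed (use Dx s in \<open>auto intro!: derivative_eq_intros\<close>)
  then show ?thesis
    using sol b0[of j] by (simp add: is_solution_def)
qed

section \<open>The normalized finite section\<close>

text \<open>
  The value 0 in degrees above \<open>N\<close> encodes the truncation: with it, one and the same formula
  describes the derivative in all degrees from 1 to \<open>N\<close>.
\<close>

definition normalized ::
  "(nat \<Rightarrow> int ^ ('d + 'd) \<Rightarrow> real \<Rightarrow> complex) \<Rightarrow> nat \<Rightarrow> (real \<Rightarrow> complex ^ 'd::finite) \<Rightarrow>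
   int ^ ('d + 'd) \<Rightarrow> real \<Rightarrow> complex"
where
  "normalized v N x \<gamma> s =
     (if mi_abs \<gamma> \<le> int N
      then v (nat (mi_abs \<gamma>)) \<gamma> s * exp (- \<i> * mi_dot \<gamma> (ext_state (x s))) else 0)"

text \<open>
  By the product rule, the derivative is the row of the finite section divided by the exponential
  of the exact solution, minus \<open>\<i>\<close> times the normalized value times the Fourier series of the field paired
  with \<open>ext_fold \<gamma>\<close>. The block entry at \<open>\<gamma> + ext_index \<alpha>\<close> is \<open>\<i>\<close> times the coefficient of that series
  at \<open>\<alpha>\<close>, so both series have the same coefficients and combine into differences.
\<close>

lemma normalized_derivative:
  fixes G :: "int ^ 'd \<Rightarrow> real \<Rightarrow> complex ^ 'd::finite"
  assumes four: "has_fourier_expansion R g G"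
    and Dx: "(x has_vector_derivative g s (x s)) (at s within S)"
    and Dv: "(v k \<gamma> has_vector_derivative
               (\<Sum>l=k..N. \<Sum>\<delta>\<in>nonneg_mi l. block_entry G s \<gamma> \<delta> * v l \<delta> s)) (at s within S)"
    and "0 \<le> s" and conv: "exp_size (x s) < R"
    and \<gamma>: "\<gamma> \<in> nonneg_mi k" and k: "k \<le> N"
  obtains d where "(normalized v N x \<gamma> has_vector_derivative d) (at s within S)"
    and "((\<lambda>\<alpha>. block_entry G s \<gamma> (\<gamma> + ext_index \<alpha>) * exp (\<i> * mi_dot \<alpha> (x s)) *
            (normalized v N x (\<gamma> + ext_index \<alpha>) s - normalized v N x \<gamma> s)) has_sum d) UNIV"
proof -
  define \<beta> where "\<beta> = ext_fold \<gamma>"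
  define row where "row = (\<Sum>l=k..N. \<Sum>\<delta>\<in>nonneg_mi l. block_entry G s \<gamma> \<delta> * v l \<delta> s)"
  define w where "w r = exp (- \<i> * mi_dot \<beta> (x r))" for r
  define d where "d = row * w s + v k \<gamma> s * (- \<i> * mi_dot \<beta> (g s (x s)) * w s)"
  have \<gamma>abs: "mi_abs \<gamma> = int k" using \<gamma> by (simp add: nonneg_mi_def)
  have U: "normalized v N x \<gamma> = (\<lambda>r. v k \<gamma> r * w r)"
    using k by (simp add: fun_eq_iff normalized_def \<gamma>abs w_def \<beta>_def mi_dot_ext_state)
  have Dm: "((\<lambda>r. mi_dot \<beta> (x r)) has_vector_derivative mi_dot \<beta> (g s (x s))) (at s within S)"
    by (rule bounded_linear.has_vector_derivative[OF bounded_linear_mi_dot Dx])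
  have "(exp has_field_derivative w s)
      (at (- \<i> * mi_dot \<beta> (x s)) within (\<lambda>r. - \<i> * mi_dot \<beta> (x r)) ` S)"
    unfolding w_def by (intro DERIV_exp[THEN has_field_derivative_at_within])
  from field_vector_diff_chain_within[OF has_vector_derivative_mult_right[OF Dm] this]
  have "(w has_vector_derivative - \<i> * mi_dot \<beta> (g s (x s)) * w s) (at s within S)"
    by (simp add: o_def w_def[abs_def])
  from has_vector_derivative_mult[OF Dv this]
  have 1: "(normalized v N x \<gamma> has_vector_derivative d) (at s within S)"
    by (simp add: U d_def row_def add.commute)
  have "((\<lambda>\<alpha>. exp (\<i> * mi_dot \<alpha> (x s)) *s G \<alpha> s) has_sum g s (x s)) UNIV"
    using four \<open>0 \<le> s\<close> conv by (simp add: has_fourier_expansion_def)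
  from has_sum_bounded_linear[OF bounded_linear_mi_dot this, of \<beta>]
  have "((\<lambda>\<alpha>. exp (\<i> * mi_dot \<alpha> (x s)) * mi_dot \<beta> (G \<alpha> s)) has_sum mi_dot \<beta> (g s (x s))) UNIV"
    by (simp add: mi_dot_scale)
  note gsum = has_sum_cmult_right[OF this, of "- \<i> * (v k \<gamma> s * w s)"]
  note rowsum = has_sum_cmult_right[OF section_row_has_sum[OF \<gamma>, of G s N v], of "w s"]
  have shift: "w s = exp (\<i> * mi_dot \<alpha> (x s)) *
      exp (- \<i> * mi_dot (\<gamma> + ext_index \<alpha>) (ext_state (x s)))" for \<alpha>
    by (simp add: w_def \<beta>_def mi_dot_ext_state ext_fold_add_ext_index mi_dot_add algebra_simps
        flip: exp_add)
  have combine: "w s * (block_entry G s \<gamma> (\<gamma> + ext_index \<alpha>) *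
        (if mi_abs (\<gamma> + ext_index \<alpha>) \<le> int N
         then v (nat (mi_abs (\<gamma> + ext_index \<alpha>))) (\<gamma> + ext_index \<alpha>) s else 0))
      + - \<i> * (v k \<gamma> s * w s) * (exp (\<i> * mi_dot \<alpha> (x s)) * mi_dot \<beta> (G \<alpha> s))
      = block_entry G s \<gamma> (\<gamma> + ext_index \<alpha>) * exp (\<i> * mi_dot \<alpha> (x s)) *
            (normalized v N x (\<gamma> + ext_index \<alpha>) s - normalized v N x \<gamma> s)" for \<alpha>
  proof -
    have "w s * (if mi_abs (\<gamma> + ext_index \<alpha>) \<le> int N
         then v (nat (mi_abs (\<gamma> + ext_index \<alpha>))) (\<gamma> + ext_index \<alpha>) s else 0)
       = exp (\<i> * mi_dot \<alpha> (x s)) * normalized v N x (\<gamma> + ext_index \<alpha>) s"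
      by (subst shift[of \<alpha>]) (simp add: normalized_def)
    moreover have "v k \<gamma> s * w s = normalized v N x \<gamma> s" by (simp add: U)
    moreover have "block_entry G s \<gamma> (\<gamma> + ext_index \<alpha>) = \<i> * mi_dot \<beta> (G \<alpha> s)"
      by (simp add: block_entry_add_ext_index \<beta>_def)
    ultimately show ?thesis by algebra
  qed
  from has_sum_add[OF rowsum gsum]
  have 2: "((\<lambda>\<alpha>. block_entry G s \<gamma> (\<gamma> + ext_index \<alpha>) * exp (\<i> * mi_dot \<alpha> (x s)) *
            (normalized v N x (\<gamma> + ext_index \<alpha>) s - normalized v N x \<gamma> s)) has_sum d) UNIV"
    unfolding combine by (simp add: d_def row_def algebra_simps)
  show ?thesis by (rule that[OF 1 2])
qed

text \<open>
  The barrier \<open>\<phi>\<close> multiplies by \<open>exp (c s) / lam\<close>, with \<open>c = speed_const * D0\<close>, when the degree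
  increases by 1, while the weight of a shell multiplies by \<open>\<rho>\<close>. The factor 2 in
  \<open>lam\<close> makes the product of the two at most \<open>1/2\<close> up to time \<open>t\<close>. Hence the terms \<open>u\<^bsub>\<gamma>+\<alpha>\<^esub> - 1\<close> contribute at most
  \<open>1/2 + 1/4 + ... = 1\<close> and the terms \<open>u\<^bsub>\<gamma>\<^esub> - 1\<close> at most \<open>1/e + 1/e\<^sup>2 + ... = speed_const - 1\<close>,
  in units of \<open>\<bar>\<gamma>\<bar> * D0 * \<phi>\<^bsub>\<gamma>\<^esub>\<close>; in total this
  is at most the derivative of \<open>\<phi>\<^bsub>\<gamma>\<^esub>\<close>.
\<close>

lemma normalized_minus_1_bound:
  fixes G :: "int ^ 'd \<Rightarrow> real \<Rightarrow> complex ^ 'd::finite"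
  assumes R: "0 < R" and D0: "0 \<le> D0"
    and four: "has_fourier_expansion R g G"
    and G: "\<And>k t. 0 \<le> t \<Longrightarrow>
              (\<Sum>\<alpha> | mi_abs \<alpha> = int k. \<Sum>j\<in>UNIV. cmod (G \<alpha> t $ j)) \<le> D0 * R powi (- int k)"
    and sol: "is_solution g x0 T x" and sect: "is_finite_section G x0 N T v"
    and N: "1 \<le> N" and t: "0 \<le> t" "t \<le> T"
    and b: "\<And>j. \<bar>Im (x0 $ j)\<bar> \<le> b" and room: "b + speed_const * D0 * t < ln R - 1"
    and lam: "lam = 2 * exp (b + 2 * speed_const * D0 * t) / R" and lam1: "lam \<le> 1"
    and \<gamma>: "\<gamma> \<in> nonneg_mi 1"
  shows "cmod (normalized v N x \<gamma> t - 1) \<le> lam ^ N * (exp (speed_const * D0 * t) - 1)"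
proof -
  define deg where "deg \<delta> = nat (mi_abs \<delta>)" for \<delta> :: "int ^ ('d + 'd)"
  define I :: "(int ^ ('d + 'd)) set" where "I = (\<Union>k\<in>{1..N}. nonneg_mi k)"
  define E where "E s = exp (speed_const * D0 * s)" for s
  define \<phi> where "\<phi> \<delta> s = lam ^ (N + 1) * (E s / lam) ^ deg \<delta>" for \<delta> s
  define h where "h \<delta> s \<alpha> = block_entry G s \<delta> (\<delta> + ext_index \<alpha>) * exp (\<i> * mi_dot \<alpha> (x s)) *
      (normalized v N x (\<delta> + ext_index \<alpha>) s - normalized v N x \<delta> s)" for \<delta> s \<alpha>
  have lam0: "0 < lam" using R by (simp add: lam)
  have E1: "1 \<le> E s" if "0 \<le> s" for s
    using that D0 speed_const_pos by (simp add: E_def)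
  have degI: "deg \<delta> = k" if "\<delta> \<in> nonneg_mi k" for \<delta> k
    using that by (simp add: deg_def nonneg_mi_def)
  have xb: "\<bar>Im (x s $ j)\<bar> \<le> b + speed_const * D0 * s" if "s \<in> {0..t}" for s j
    by (rule solution_Im_bound[OF R D0 four G sol t(2) b room that])
  have mono: "speed_const * D0 * s \<le> speed_const * D0 * t" if "s \<in> {0..t}" for s
    using that D0 speed_const_pos by (intro mult_left_mono) auto
  have deriv: "(normalized v N x \<delta> has_vector_derivative infsum (h \<delta> s) UNIV) (at s within {0..t})
      \<and> (h \<delta> s has_sum infsum (h \<delta> s) UNIV) UNIV" if "\<delta> \<in> I" and s: "s \<in> {0..t}" for \<delta> s
  proof -
    from \<open>\<delta> \<in> I\<close> obtain k where k: "1 \<le> k" "k \<le> N" and \<delta>: "\<delta> \<in> nonneg_mi k"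
      by (auto simp: I_def)
    have sub: "{0..t} \<subseteq> {0..T}" and "s \<in> {0..T}" using s t by auto
    have Dx: "(x has_vector_derivative g s (x s)) (at s within {0..t})"
      using sol sub \<open>s \<in> {0..T}\<close> unfolding is_solution_def
      by (blast intro: has_vector_derivative_within_subset)
    have Dv: "(v k \<delta> has_vector_derivative
        (\<Sum>l=k..N. \<Sum>\<delta>'\<in>nonneg_mi l. block_entry G s \<delta> \<delta>' * v l \<delta>' s)) (at s within {0..t})"
    proof (rule has_vector_derivative_within_subset[OF _ sub])
      show "(v k \<delta> has_vector_derivative
          (\<Sum>l=k..N. \<Sum>\<delta>'\<in>nonneg_mi l. block_entry G s \<delta> \<delta>' * v l \<delta>' s)) (at s within {0..T})"
        using sect \<open>s \<in> {0..T}\<close> k \<delta> unfolding is_finite_section_def by simp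
    qed
    have "b + speed_const * D0 * s \<le> ln R - 1" using mono[OF s] room by simp
    then have "exp_size (x s) \<le> exp (ln R - 1)"
      using xb[OF s] by (auto simp: exp_size_le_exp_iff intro: order_trans)
    also have "\<dots> < R" using R by (simp add: exp_diff divide_less_eq)
    finally have conv: "exp_size (x s) < R" .
    obtain d where d: "(normalized v N x \<delta> has_vector_derivative d) (at s within {0..t})"
      "(h \<delta> s has_sum d) UNIV"
      unfolding h_def
      by (rule normalized_derivative[OF four Dx Dv _ conv \<delta> k(2)]) (use s in auto)
    then show ?thesis using infsumI[OF d(2)] by simp
  qed
  have init: "normalized v N x \<delta> 0 = 1" if "\<delta> \<in> I" for \<delta>
  proof -
    from that obtain k where k: "1 \<le> k" "k \<le> N" and \<delta>: "\<delta> \<in> nonneg_mi k"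
      by (auto simp: I_def)
    then have "v k \<delta> 0 = exp (\<i> * mi_dot \<delta> (ext_state x0))"
      using sect by (auto simp: is_finite_section_def)
    moreover have "mi_abs \<delta> = int k" using \<delta> by (simp add: nonneg_mi_def)
    ultimately show ?thesis
      using k sol by (simp add: normalized_def is_solution_def flip: exp_add)
  qed
  have "\<gamma> \<in> I" using \<gamma> N by (auto simp: I_def)
  have "norm (normalized v N x \<gamma> t - 1) \<le> norm (normalized v N x \<gamma> 0 - 1) + \<phi> \<gamma> t - \<phi> \<gamma> 0"
  proof (rule barrier_comparison[where I = I and t = t and f = "\<lambda>\<delta> s. normalized v N x \<delta> s - 1"
        and f' = "\<lambda>\<delta> s. infsum (h \<delta> s) UNIV" and \<phi> = \<phi>
        and \<phi>' = "\<lambda>\<delta> s. real (deg \<delta>) * (speed_const * D0) * \<phi> \<delta> s"])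
    show "finite I" by (simp add: I_def finite_nonneg_mi)
    show "t \<in> {0..t}" using t by simp
  next
    fix \<delta> s assume "\<delta> \<in> I" "s \<in> {0..t}"
    then have "(normalized v N x \<delta> has_vector_derivative infsum (h \<delta> s) UNIV) (at s within {0..t})"
      using deriv by blast
    from has_vector_derivative_diff[OF this has_vector_derivative_const[of 1]]
    show "((\<lambda>s. normalized v N x \<delta> s - 1) has_vector_derivative infsum (h \<delta> s) UNIV)
        (at s within {0..t})" by simp
  next
    fix \<delta> s assume "\<delta> \<in> I" "s \<in> {0..t}"
    have eq: "\<phi> \<delta> = (\<lambda>s. lam ^ (N + 1) / lam ^ deg \<delta> * exp (real (deg \<delta>) * (speed_const * D0) * s))"
      by (simp add: fun_eq_iff \<phi>_def E_def power_divide algebra_simps flip: exp_of_nat_mult)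
    show "(\<phi> \<delta> has_vector_derivative real (deg \<delta>) * (speed_const * D0) * \<phi> \<delta> s) (at s within {0..t})"
      unfolding eq has_real_derivative_iff_has_vector_derivative[symmetric]
      using lam0 by (auto intro!: derivative_eq_intros)
  next
    fix \<delta> assume "\<delta> \<in> I"
    then show "norm (normalized v N x \<delta> 0 - 1) < \<phi> \<delta> 0"
      using init lam0 by (simp add: \<phi>_def E_def)
  next
    fix s \<delta> assume s: "s \<in> {0..t}" and "\<delta> \<in> I"
      and below: "\<And>\<delta>. \<delta> \<in> I \<Longrightarrow> norm (normalized v N x \<delta> s - 1) \<le> \<phi> \<delta> s"
    then obtain k where k: "1 \<le> k" "k \<le> N" and \<delta>: "\<delta> \<in> nonneg_mi k"
      by (auto simp: I_def)
    have \<phi>0: "0 \<le> \<phi> \<delta> s" for \<delta> using lam0 by (simp add: \<phi>_def E_def)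
    have all: "norm (normalized v N x \<delta>' s - 1) \<le> \<phi> \<delta>' s" if l: "1 \<le> l" and \<delta>': "\<delta>' \<in> nonneg_mi l" for \<delta>' l
    proof (cases "l \<le> N")
      case True
      then show ?thesis using l \<delta>' by (intro below) (auto simp: I_def)
    next
      \<comment> \<open>Beyond the truncation order the normalized value is 0, and the barrier exceeds 1.\<close>
      case False
      have "1 = lam ^ (N + 1) / lam ^ (N + 1)" using lam0 by simp
      also have "\<dots> \<le> lam ^ (N + 1) / lam ^ l"
        using lam0 lam1 False by (intro divide_left_mono power_decreasing) auto
      also have "\<dots> \<le> lam ^ (N + 1) * E s ^ l / lam ^ l"
        using lam0 E1[of s] s by (intro divide_right_mono) (simp_all add: one_le_power)
      also have "\<dots> = \<phi> \<delta>' s" by (simp add: \<phi>_def degI[OF \<delta>'] power_divide)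
      finally have "1 \<le> \<phi> \<delta>' s" .
      moreover have "mi_abs \<delta>' = int l" using \<delta>' by (simp add: nonneg_mi_def)
      ultimately show ?thesis using False by (simp add: normalized_def)
    qed
    define K where "K = real k * \<phi> \<delta> s * D0"
    have K0: "0 \<le> K" using \<phi>0 D0 by (simp add: K_def)
    define \<rho> where "\<rho> = exp (b + speed_const * D0 * s) / R"
    have \<rho>0: "0 \<le> \<rho>" using R by (simp add: \<rho>_def)
    have "exp (b + speed_const * D0 * s) \<le> exp (ln R - 1)" using mono[OF s] room by simp
    then have \<rho>e: "\<rho> \<le> 1 / exp 1" using R by (simp add: \<rho>_def exp_diff field_simps)
    have "\<rho> * (E s / lam) = exp (b + 2 * (speed_const * D0 * s)) / (2 * exp (b + 2 * (speed_const * D0 * t)))"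
      using R by (simp add: \<rho>_def E_def lam field_simps flip: exp_add)
    also have "\<dots> \<le> exp (b + 2 * (speed_const * D0 * t)) / (2 * exp (b + 2 * (speed_const * D0 * t)))"
      using mono[OF s] by (intro divide_right_mono) auto
    finally have \<rho>half: "\<rho> * (E s / lam) \<le> 1 / 2" by simp
    \<comment> \<open>The shell of \<open>m = 0\<close> vanishes, so the terms of both geometric series at 0 are removed.\<close>
    define c :: "nat \<Rightarrow> real" where "c m = K * ((1/2) ^ m + (1 / exp 1) ^ m - (if m = 0 then 2 else 0))" for m
    have "norm (infsum (h \<delta> s) UNIV) \<le> K * (2 + speed_const - 2)"
    proof (rule norm_has_sum_le_shells)
      show "(h \<delta> s has_sum infsum (h \<delta> s) UNIV) UNIV"
        using deriv[OF \<open>\<delta> \<in> I\<close> s] by blast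
      have "(\<lambda>m. (1/2) ^ m :: real) sums 2" using geometric_sums[of "1/2::real"] by simp
      then show "c sums (K * (2 + speed_const - 2))"
        unfolding c_def
        by (intro sums_mult sums_diff sums_add geometric_sums_speed_const sums_single[of 0 "\<lambda>_. 2::real", simplified])
      fix m
      show "(\<Sum>\<alpha> | mi_abs \<alpha> = int m. norm (h \<delta> s \<alpha>)) \<le> c m"
      proof (cases "m = 0")
        case True
        have "h \<delta> s \<alpha> = 0" if "mi_abs \<alpha> = 0" for \<alpha>
        proof -
          have "ext_index \<alpha> = 0" using that by (metis mi_abs_eq_0_iff mi_abs_ext_index)
          then show ?thesis by (simp add: h_def)
        qed
        then show ?thesis using True by (simp add: c_def)
      next
        case False
        have "norm (h \<delta> s \<alpha>) \<le> real k * \<phi> \<delta> s * ((E s / lam) ^ m + 1) *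
            (cmod (exp (\<i> * mi_dot \<alpha> (x s))) * (\<Sum>j\<in>UNIV. cmod (G \<alpha> s $ j)))"
          if \<alpha>: "mi_abs \<alpha> = int m" for \<alpha>
        proof -
          have m: "\<delta> + ext_index \<alpha> \<in> nonneg_mi (k + m)"
            using nonneg_add_ext_index[OF \<delta>, of \<alpha>] \<alpha> by simp
          have "\<phi> (\<delta> + ext_index \<alpha>) s = \<phi> \<delta> s * (E s / lam) ^ m"
            by (simp add: \<phi>_def degI[OF m] degI[OF \<delta>] power_add)
          moreover have "norm (normalized v N x (\<delta> + ext_index \<alpha>) s - normalized v N x \<delta> s)
              \<le> \<phi> (\<delta> + ext_index \<alpha>) s + \<phi> \<delta> s"
            using all[OF _ m] all[OF k(1) \<delta>] k(1)
              norm_triangle_ineq4[of "normalized v N x (\<delta> + ext_index \<alpha>) s - 1" "normalized v N x \<delta> s - 1"]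
            by simp
          ultimately have diff: "norm (normalized v N x (\<delta> + ext_index \<alpha>) s - normalized v N x \<delta> s)
              \<le> \<phi> \<delta> s * ((E s / lam) ^ m + 1)" by (simp add: algebra_simps)
          have "norm (h \<delta> s \<alpha>) \<le> (real k * (\<Sum>j\<in>UNIV. cmod (G \<alpha> s $ j))) *
              cmod (exp (\<i> * mi_dot \<alpha> (x s))) * (\<phi> \<delta> s * ((E s / lam) ^ m + 1))"
            unfolding h_def norm_mult
            by (intro mult_mono norm_block_entry_le[OF \<delta>] diff order_refl mult_nonneg_nonneg sum_nonneg) auto
          then show ?thesis by (simp add: algebra_simps)
        qed
        then have "(\<Sum>\<alpha> | mi_abs \<alpha> = int m. norm (h \<delta> s \<alpha>)) \<le> (\<Sum>\<alpha> | mi_abs \<alpha> = int m.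
            real k * \<phi> \<delta> s * ((E s / lam) ^ m + 1) *
            (cmod (exp (\<i> * mi_dot \<alpha> (x s))) * (\<Sum>j\<in>UNIV. cmod (G \<alpha> s $ j))))"
          by (intro sum_mono) simp
        also have "\<dots> \<le> real k * \<phi> \<delta> s * ((E s / lam) ^ m + 1) * (D0 * \<rho> ^ m)"
          unfolding sum_distrib_left[symmetric] \<rho>_def
        proof (intro mult_left_mono fourier_shell_bound[OF R])
          show "0 \<le> real k * \<phi> \<delta> s * ((E s / lam) ^ m + 1)"
            using \<phi>0 lam0 by (simp add: E_def)
        qed (use G s xb[OF s] in auto)
        also have "\<dots> = K * ((\<rho> * (E s / lam)) ^ m + \<rho> ^ m)"
          by (simp add: K_def algebra_simps power_mult_distrib power_divide)
        also have "\<dots> \<le> K * ((1/2) ^ m + (1 / exp 1) ^ m)"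
          using K0 \<rho>0 \<rho>e \<rho>half lam0
          by (intro mult_left_mono add_mono power_mono) (auto simp: E_def)
        finally show ?thesis using False by (simp add: c_def)
      qed
    qed
    then show "norm (infsum (h \<delta> s) UNIV) \<le> real (deg \<delta>) * (speed_const * D0) * \<phi> \<delta> s"
      by (simp add: K_def degI[OF \<delta>] algebra_simps)
  qed (fact \<open>\<gamma> \<in> I\<close>)
  also have "\<dots> = lam ^ N * (exp (speed_const * D0 * t) - 1)"
    using lam0 by (simp add: init[OF \<open>\<gamma> \<in> I\<close>] \<phi>_def degI[OF \<gamma>] E_def field_simps)
  finally show ?thesis .
qed

section \<open>Passage to the closed form of the bound\<close>

lemma cube_times_power_le:
  assumes "1 \<le> n"
  shows "real n ^ 3 * (14/25) ^ n \<le> 9"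
proof (cases "n \<le> 5")
  case True
  then have "n \<in> {1, 2, 3, 4, 5}" using assms by auto
  then show ?thesis by (auto simp: power_numeral_reduce)
next
  case False
  then have "5 \<le> n" by simp
  then show ?thesis
  proof (induction n rule: dec_induct)
    case base
    show ?case by (simp add: power_numeral_reduce)
  next
    case (step n)
    have "real (Suc n) \<le> 6/5 * real n" using step.hyps by simp
    then have "real (Suc n) ^ 3 \<le> (6/5 * real n) ^ 3" by (intro power_mono) auto
    then have "real (Suc n) ^ 3 * (14/25) ^ Suc n \<le> (6/5 * real n) ^ 3 * (14/25) ^ Suc n"
      by (intro mult_right_mono) auto
    also have "\<dots> = (216/125 * (14/25)) * (real n ^ 3 * (14/25) ^ n)"
      by (simp add: power_mult_distrib power_numeral_reduce)
    also have "\<dots> \<le> 1 * 9" using step.IH by (intro mult_mono) auto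
    finally show ?case by simp
  qed
qed

text \<open>
  After squaring this is \<open>cube_times_power_le\<close>, because \<open>4 / e\<^sup>2 \<le> 14 / 25\<close>.
\<close>

lemma two_over_e_power_le:
  assumes "1 \<le> N"
  shows "(2 / exp 1) ^ N \<le> 3 * real N powr (- 3 / 2)"
proof -
  have e: "27/10 \<le> exp (1::real)"
    using e_approx_32 by (simp add: abs_if split: if_split_asm)
  have "(27/10) ^ 2 \<le> exp (1::real) ^ 2"
    using e by (intro power_mono) auto
  then have "(2 / exp 1) ^ 2 \<le> (14/25 :: real)"
    by (simp add: power_divide field_simps)
  then have "((2 / exp 1) ^ 2) ^ N \<le> (14/25 :: real) ^ N"
    by (intro power_mono) auto
  also have "\<dots> \<le> 9 / real N ^ 3"
    using cube_times_power_le[OF assms] assms by (simp add: field_simps)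
  also have "\<dots> = (3 * real N powr (- 3 / 2)) ^ 2"
  proof -
    have "(real N powr (- 3 / 2)) ^ 2 = real N powr (- 3)"
      using assms by (simp add: powr_power)
    also have "\<dots> = 1 / real N ^ 3"
      using assms by (simp add: powr_minus powr_numeral field_simps)
    finally show ?thesis by (simp add: power_mult_distrib)
  qed
  finally have "((2 / exp 1) ^ N) ^ 2 \<le> (3 * real N powr (- 3 / 2)) ^ 2"
    by (simp only: power_mult[symmetric] mult.commute)
  then show ?thesis by (rule power2_le_imp_le) simp
qed

lemma minus_1_le_fourth_power:
  fixes y :: real
  shows "y - 1 \<le> y ^ 4 / 8"
proof -
  \<comment> \<open>This is \<open>y^4 - 8 * y + 8\<close> written as a sum of squares.\<close>
  have "0 \<le> (y ^ 2 - 2) ^ 2 + 4 * (y - 1) ^ 2" by simp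
  then show ?thesis by (simp add: power2_eq_square power4_eq_xxxx algebra_simps)
qed

text \<open>
  In the application \<open>b\<close> is the logarithm of the initial size of the exponentials, so \<open>L\<close> measures
  their distance from \<open>R / e\<close>, and \<open>lam = (2 / e) * exp (2 * speed_const * D0 * t - L)\<close>. On the time interval in question
  \<open>2 * speed_const * D0 * t \<le> L\<close>. This gives \<open>lam \<le> 1\<close>, leaves room below \<open>ln R - 1\<close>, and bounds
  \<open>exp (speed_const * D0 * t) - 1\<close> by \<open>exp (2 * L) / 8\<close>, while
  \<open>R\<^sup>2 \<ge> exp (2 + 2 * L)\<close>. With \<open>t\<^sub>1\<close> for the end of the interval, the exponent in \<open>lam\<close> is at most
  \<open>2 * D0 * (t - t\<^sub>1)\<close>, the exponent per unit of \<open>N\<close> in the claim; the factor \<open>(2 / e) ^ N\<close> is left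
  over to pay for \<open>N powr (-3/2)\<close>.
\<close>

lemma closed_form_bound:
  fixes R b L D0 t :: real
  assumes D0: "0 < D0" and R: "0 < R" and L: "L = ln R - 1 - b" "0 < L" and b: "0 \<le> b" and N: "1 \<le> N"
    and t: "0 \<le> t" "t \<le> (exp 1 - 1) / (2 * D0 * (2 * exp 1 - 1)) * L"
    and lam: "lam = 2 * exp (b + 2 * speed_const * D0 * t) / R"
  shows "b + speed_const * D0 * t < ln R - 1" and "lam \<le> 1"
    and "lam ^ N * (exp (speed_const * D0 * t) - 1)
      \<le> R\<^sup>2 / (sqrt (2 * pi) * exp 1 * (exp 1 - 1)) * real N powr (- 3 / 2)
         * exp (2 * D0 * (t - (exp 1 - 1) / (2 * D0 * (2 * exp 1 - 1)) * L) * real N)"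
proof -
  define q :: real where "q = (exp 1 - 1) / (2 * (2 * exp 1 - 1))"
  have e: "27/10 \<le> exp (1::real)" "exp (1::real) \<le> 3"
    using e_approx_32 exp_le by (simp_all add: abs_if split: if_split_asm)
  have qL: "(exp 1 - 1) / (2 * D0 * (2 * exp 1 - 1)) * L = q * L / D0"
    by (simp add: q_def)
  have t': "D0 * t \<le> q * L"
    using t(2) D0 unfolding qL by (simp add: field_simps)
  have kq: "2 * speed_const * q = exp 1 / (2 * exp 1 - 1)"
  proof -
    have "2 * (E / A) * (A / (2 * B)) = E / B" if "A \<noteq> 0" for A B E :: real
      using that by simp
    moreover have "exp 1 - 1 \<noteq> (0::real)" using e by simp
    ultimately show ?thesis unfolding speed_const_def q_def by blast
  qed
  have kq1: "2 * speed_const * q \<le> 1" unfolding kq using e by simp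
  have growth: "2 * speed_const * D0 * t \<le> L"
  proof -
    have "2 * speed_const * (D0 * t) \<le> 2 * speed_const * (q * L)"
      using t' speed_const_pos by (intro mult_left_mono) auto
    also have "\<dots> \<le> 1 * L" using mult_right_mono[OF kq1, of L] L by (simp add: mult.assoc)
    finally show ?thesis by (simp add: mult.assoc)
  qed
  have R_eq: "R = exp (1 + L + b)" using R L by simp
  have lam_eq: "lam = 2 / exp 1 * exp (2 * speed_const * D0 * t - L)"
    by (simp add: lam R_eq exp_add exp_diff field_simps)
  show "b + speed_const * D0 * t < ln R - 1"
    using growth L by simp
  show "lam \<le> 1"
  proof -
    have "2 / exp 1 * exp (2 * speed_const * D0 * t - L) \<le> 1 * 1"
      using growth e by (intro mult_mono) auto
    then show ?thesis by (simp add: lam_eq)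
  qed
  have rate: "2 * speed_const * D0 * t - L \<le> 2 * (D0 * t - q * L)"
  proof -
    have k: "2 * speed_const - 2 = 2 / (exp 1 - 1)" by (simp add: speed_const_eq(2))
    have "(2 * speed_const - 2) * (D0 * t) \<le> (2 * speed_const - 2) * (q * L)"
      unfolding k using t' e by (intro mult_left_mono) auto
    moreover have "2 * speed_const * q * L \<le> 1 * L" using kq1 L by (intro mult_right_mono) auto
    ultimately show ?thesis by (simp add: algebra_simps)
  qed
  have "lam ^ N = (2 / exp 1) ^ N * exp (real N * (2 * speed_const * D0 * t - L))"
    by (simp only: lam_eq power_mult_distrib exp_of_nat_mult)
  also have "\<dots> \<le> 3 * real N powr (- 3 / 2) * exp (real N * (2 * (D0 * t - q * L)))"
    using two_over_e_power_le[OF N] rate by (intro mult_mono) (auto intro: mult_left_mono)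
  finally have lamN: "lam ^ N \<le> 3 * real N powr (- 3 / 2) * exp (real N * (2 * (D0 * t - q * L)))" .
  have "exp (speed_const * D0 * t) - 1 \<le> exp (speed_const * D0 * t) ^ 4 / 8"
    by (rule minus_1_le_fourth_power)
  also have "\<dots> = exp (2 * (2 * speed_const * D0 * t)) / 8"
    by (simp flip: exp_of_nat_mult)
  also have "\<dots> \<le> exp (2 * L) / 8"
    using growth by (simp add: mult_ac)
  finally have birth: "exp (speed_const * D0 * t) - 1 \<le> exp (2 * L) / 8" .
  have const: "3 * (exp (2 * L) / 8) \<le> R\<^sup>2 / (sqrt (2 * pi) * exp 1 * (exp 1 - 1))"
  proof -
    have "sqrt (2 * pi) \<le> 3"
      by (rule real_le_lsqrt) (use pi_less_4 in auto)
    then have "3 / 8 * (sqrt (2 * pi) * (exp 1 - 1)) \<le> 3 / 8 * (3 * (exp 1 - 1))"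
      using e by (intro mult_left_mono mult_right_mono) auto
    also have "\<dots> \<le> exp (1::real)" using e by simp
    finally have "3 / 8 \<le> exp 1 / (sqrt (2 * pi) * (exp 1 - 1))"
      using e by (simp add: field_simps)
    then have "3 / 8 * exp (2 * L) \<le> exp 1 / (sqrt (2 * pi) * (exp 1 - 1)) * exp (2 * L)"
      by (intro mult_right_mono) auto
    also have "\<dots> = exp (2 * (1 + L)) / (sqrt (2 * pi) * exp 1 * (exp 1 - 1))"
    proof -
      have "exp (2 * (1 + L)) = exp 1 * (exp 1 * exp (2 * L))"
        by (simp add: algebra_simps flip: exp_add)
      then show ?thesis by simp
    qed
    also have "\<dots> \<le> R\<^sup>2 / (sqrt (2 * pi) * exp 1 * (exp 1 - 1))"
    proof (rule divide_right_mono)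
      show "exp (2 * (1 + L)) \<le> R\<^sup>2"
        using b unfolding R_eq by (simp flip: exp_of_nat_mult)
    qed (use e in auto)
    finally show ?thesis by simp
  qed
  have "lam ^ N * (exp (speed_const * D0 * t) - 1)
     \<le> (3 * real N powr (- 3 / 2) * exp (real N * (2 * (D0 * t - q * L)))) * (exp (2 * L) / 8)"
    using lamN birth t D0 speed_const_pos by (intro mult_mono) auto
  also have "\<dots> = 3 * (exp (2 * L) / 8) * (real N powr (- 3 / 2) * exp (real N * (2 * (D0 * t - q * L))))"
    by simp
  also have "\<dots> \<le> R\<^sup>2 / (sqrt (2 * pi) * exp 1 * (exp 1 - 1)) *
      (real N powr (- 3 / 2) * exp (real N * (2 * (D0 * t - q * L))))"
    by (intro mult_right_mono const) auto
  also have "real N * (2 * (D0 * t - q * L)) = 2 * D0 * (t - q * L / D0) * real N"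
    using D0 by (simp add: field_simps)
  finally show "lam ^ N * (exp (speed_const * D0 * t) - 1)
      \<le> R\<^sup>2 / (sqrt (2 * pi) * exp 1 * (exp 1 - 1)) * real N powr (- 3 / 2)
         * exp (2 * D0 * (t - (exp 1 - 1) / (2 * D0 * (2 * exp 1 - 1)) * L) * real N)"
    unfolding qL by (simp only: mult.assoc)
qed

lemma normalized_axis:
  fixes j :: "'d::finite"
  assumes "1 \<le> N"
  shows "normalized v N x (axis (Inl j) 1) t = v 1 (axis (Inl j) 1) t * exp (- \<i> * x t $ j)"
    and "normalized v N x (axis (Inr j) 1) t = v 1 (axis (Inr j) 1) t * exp (\<i> * x t $ j)"
  using assms axis_in_nonneg_mi[of "Inl j :: 'd + 'd"] axis_in_nonneg_mi[of "Inr j :: 'd + 'd"]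
  by (simp_all add: normalized_def nonneg_mi_def mi_dot_axis ext_state_def)

theorem corollary4p2:
  fixes D0 R T :: real
    and g :: "real \<Rightarrow> complex ^ 'd::finite \<Rightarrow> complex ^ 'd"
    and G :: "int ^ 'd \<Rightarrow> real \<Rightarrow> complex ^ 'd"
    and x0 :: "complex ^ 'd"
    and x :: "real \<Rightarrow> complex ^ 'd"
    and N :: nat
    and v :: "nat \<Rightarrow> int ^ ('d + 'd) \<Rightarrow> real \<Rightarrow> complex"
  assumes "D0 > 0" and "R > exp 1"
    and "periodic_field g"
    and "has_fourier_expansion R g G"
    and "\<And>k t. 0 \<le> t \<Longrightarrow>
           (\<Sum>\<alpha> | mi_abs \<alpha> = int k. \<Sum>j\<in>UNIV. cmod (G \<alpha> t $ j)) \<le> D0 * R powi (- int k)"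
    and "is_solution g x0 T x"
    and "N \<ge> 1"
    and "is_finite_section G x0 N T v"
  shows
    "(exp_size x0 < R / exp 1 \<longrightarrow>
        (\<forall>j t. 0 \<le> t \<and> t \<le> T \<and> t \<le> T_CF D0 R x0 \<longrightarrow>
           max (cmod (v 1 (axis (Inl j) 1) t * exp (- \<i> * x t $ j) - 1))
               (cmod (v 1 (axis (Inr j) 1) t * exp (\<i> * x t $ j) - 1))
           \<le> R\<^sup>2 / (sqrt (2 * pi) * exp 1 * (exp 1 - 1)) * real N powr (- 3 / 2)
               * exp (2 * D0 * (t - T_CF D0 R x0) * real N)))
     \<and> ((\<forall>j. x0 $ j \<in> \<real>) \<longrightarrow>
        (\<forall>j t. 0 \<le> t \<and> t \<le> T \<and> t \<le> (exp 1 - 1) * (ln R - 1) / (2 * D0 * (2 * exp 1 - 1)) \<longrightarrow>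
           max (cmod (v 1 (axis (Inl j) 1) t * exp (- \<i> * x t $ j) - 1))
               (cmod (v 1 (axis (Inr j) 1) t * exp (\<i> * x t $ j) - 1))
           \<le> R\<^sup>2 / (sqrt (2 * pi) * exp 1 * (exp 1 - 1) * real N powr (3 / 2))
               * exp (2 * D0 * real N * t
                      - (exp 1 - 1) * (ln R - 1) / (2 * exp 1 - 1) * real N)))"
proof -
  have main: "max (cmod (v 1 (axis (Inl j) 1) t * exp (- \<i> * x t $ j) - 1))
               (cmod (v 1 (axis (Inr j) 1) t * exp (\<i> * x t $ j) - 1))
           \<le> R\<^sup>2 / (sqrt (2 * pi) * exp 1 * (exp 1 - 1)) * real N powr (- 3 / 2)
               * exp (2 * D0 * (t - T_CF D0 R x0) * real N)"
    if small: "exp_size x0 < R / exp 1" and t: "0 \<le> t" "t \<le> T" "t \<le> T_CF D0 R x0" for j t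
  proof -
    have R: "0 < R" using \<open>R > exp 1\<close> exp_gt_zero[of "1::real"] by linarith
    define b where "b = ln (exp_size x0)"
    define L where "L = ln R - 1 - b"
    define lam where "lam = 2 * exp (b + 2 * speed_const * D0 * t) / R"
    have b: "0 \<le> b" using exp_size_ge_1[of x0] by (simp add: b_def)
    have "b < ln (R / exp 1)"
      using small exp_size_ge_1[of x0] R by (simp add: b_def)
    then have L: "0 < L" using R by (simp add: L_def ln_div)
    have T: "T_CF D0 R x0 = (exp 1 - 1) / (2 * D0 * (2 * exp 1 - 1)) * L"
      by (simp add: T_CF_def L_def b_def)
    note conv = closed_form_bound[OF \<open>D0 > 0\<close> R L_def L b \<open>N \<ge> 1\<close> t(1) t(3)[unfolded T] lam_def]
    have "cmod (normalized v N x (axis s 1) t - 1) \<le> lam ^ N * (exp (speed_const * D0 * t) - 1)" for s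
      using abs_Im_le_ln_exp_size[of x0] \<open>D0 > 0\<close>
      by (intro normalized_minus_1_bound[OF R _ assms(4,5,6,8,7) t(1,2) _ conv(1) lam_def conv(2)
            axis_in_nonneg_mi]) (auto simp: b_def)
    then have "cmod (normalized v N x (axis s 1) t - 1)
        \<le> R\<^sup>2 / (sqrt (2 * pi) * exp 1 * (exp 1 - 1)) * real N powr (- 3 / 2)
               * exp (2 * D0 * (t - T_CF D0 R x0) * real N)" for s
      using conv(3) unfolding T by (rule order_trans)
    from this[of "Inl j"] this[of "Inr j"] show ?thesis
      by (simp only: normalized_axis[OF \<open>N \<ge> 1\<close>] max.bounded_iff)
  qed
  show ?thesis
  proof (intro conjI impI allI; (elim conjE)?)
    fix j t
    assume "exp_size x0 < R / exp 1" "0 \<le> t" "t \<le> T" "t \<le> T_CF D0 R x0"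
    then show "max (cmod (v 1 (axis (Inl j) 1) t * exp (- \<i> * x t $ j) - 1))
               (cmod (v 1 (axis (Inr j) 1) t * exp (\<i> * x t $ j) - 1))
           \<le> R\<^sup>2 / (sqrt (2 * pi) * exp 1 * (exp 1 - 1)) * real N powr (- 3 / 2)
               * exp (2 * D0 * (t - T_CF D0 R x0) * real N)"
      by (rule main)
  next
    fix j t
    assume real: "\<forall>j. x0 $ j \<in> \<real>" and t: "0 \<le> t" "t \<le> T"
      "t \<le> (exp 1 - 1) * (ln R - 1) / (2 * D0 * (2 * exp 1 - 1))"
    have "exp_size x0 \<le> exp 0"
      unfolding exp_size_le_exp_iff using real by (simp add: complex_is_Real_iff)
    then have size: "exp_size x0 = 1" using exp_size_ge_1[of x0] by simp
    then have T: "T_CF D0 R x0 = (exp 1 - 1) * (ln R - 1) / (2 * D0 * (2 * exp 1 - 1))"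
      by (simp add: T_CF_def)
    have "exp_size x0 < R / exp 1" using \<open>R > exp 1\<close> by (simp add: size)
    note main[OF this t(1,2) t(3)[folded T], of j]
    also have "R\<^sup>2 / (sqrt (2 * pi) * exp 1 * (exp 1 - 1)) * real N powr (- 3 / 2)
        = R\<^sup>2 / (sqrt (2 * pi) * exp 1 * (exp 1 - 1) * real N powr (3 / 2))"
    proof -
      have "real N powr (- 3 / 2) = 1 / real N powr (3 / 2)"
        using powr_minus_divide[of "real N" "3 / 2"] by simp
      then show ?thesis by (simp only: times_divide_times_eq mult_1_right)
    qed
    also have "2 * D0 * (t - T_CF D0 R x0) * real N = 2 * D0 * real N * t
                      - (exp 1 - 1) * (ln R - 1) / (2 * exp 1 - 1) * real N"
    proof -
      have "2 * D0 * (A / (2 * D0 * B)) = A / B" for A B :: real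
        using \<open>D0 > 0\<close> by simp
      then have eq: "2 * D0 * T_CF D0 R x0 = (exp 1 - 1) * (ln R - 1) / (2 * exp 1 - 1)"
        unfolding T .
      have "2 * D0 * (t - C) * real N = 2 * D0 * real N * t - 2 * D0 * C * real N" for C
        by (simp add: algebra_simps)
      then show ?thesis unfolding eq[symmetric] .
    qed
    finally show "max (cmod (v 1 (axis (Inl j) 1) t * exp (- \<i> * x t $ j) - 1))
               (cmod (v 1 (axis (Inr j) 1) t * exp (\<i> * x t $ j) - 1))
           \<le> R\<^sup>2 / (sqrt (2 * pi) * exp 1 * (exp 1 - 1) * real N powr (3 / 2))
               * exp (2 * D0 * real N * t
                      - (exp 1 - 1) * (ln R - 1) / (2 * exp 1 - 1) * real N)" .
  qed
qed

end
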